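(* Let $\beta_0=2\sqrt{2}$, let $\beta$ be a real number with $\beta>\beta_0$, and let $p$ be analytic in $\mathbb{D}$ with $p(0)=1$. If $$p^2(z)+\frac{\beta zp'(z)}{p^2(z)}\prec 1+z,$$ then $p(z)\prec\sqrt{1+z}$.
   Context: $\mathbb{D}=\{z\in\mathbb{C}:|z|<1\}$; $p^k(z)=(p(z))^k$. For analytic $f,g$ on $\mathbb{D}$, $f\prec g$ ($f$ is subordinate to $g$) means there is an analytic $w:\mathbb{D}\to\mathbb{D}$ with $w(0)=0$ and $f(z)=g(w(z))$ for all $z\in\mathbb{D}$; in particular the left-hand side of a subordination is understood to be an analytic function on $\mathbb{D}$. $\sqrt{1+z}$ is the principal branch; it maps $\mathbb{D}$ univalently onto $\{w:|w^2-1|<1,\ \operatorname{Re}w>0\}$. *)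

theory Defs
  imports "HOL-Complex_Analysis.Complex_Analysis"
begin

abbreviation unit_disc :: "complex set" ("\<D>") where
  "\<D> \<equiv> ball 0 1"

(* Subordination f \<prec> g is a relation between analytic functions on the disc, so their
   analyticity is part of it.  A division by zero inside f or g is Isabelle's total x / 0 = 0,
   hence a pole of such an expression in the disc makes it fail to be holomorphic there. *)
definition subordinate :: "(complex \<Rightarrow> complex) \<Rightarrow> (complex \<Rightarrow> complex) \<Rightarrow> bool"
    (infix "\<prec>" 50) where
  "f \<prec> g \<longleftrightarrow> f holomorphic_on \<D> \<and> g holomorphic_on \<D> \<and>
     (\<exists>w. w holomorphic_on \<D> \<and> w ` \<D> \<subseteq> \<D> \<and> w 0 = 0 \<and> (\<forall>z\<in>\<D>. f z = g (w z)))"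

end

theory Submission
  imports Defs
begin

text \<open>The zeros of \<open>p\<close> are ruled out first: at a zero, \<open>p'/p\<^sup>2\<close> would have a pole.
  Put \<open>w = p\<^sup>2 - 1\<close>. If \<open>|w| < 1\<close> failed, then at a point \<open>a\<close> of least modulus with \<open>|w a| = 1\<close>
  Jack's lemma would give \<open>a w'(a) = m w(a)\<close> with \<open>m \<ge> 1\<close>, and the left-hand side of the
  subordination minus 1 would be \<open>w(a) (1 + (\<beta> m / 2) / p(a)\<^sup>3)\<close>. On the lemniscate
  \<open>Re (s\<^sup>3) \<ge> -1/4\<close>, so this number has modulus at least 1, a contradiction.\<close>

section \<open>Schwarz's lemma on smaller discs and Jack's lemma\<close>

lemma has_real_derivative_nonpos_if_max_right:
  fixes f :: "real \<Rightarrow> real"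
  assumes "(f has_real_derivative l) (at x)" and "\<And>t. t > 0 \<Longrightarrow> f (x + t) \<le> f x"
  shows "l \<le> 0"
proof (rule ccontr)
  assume "\<not> l \<le> 0"
  then obtain d where "d > 0" "\<forall>h>0. h < d \<longrightarrow> f x < f (x + h)"
    using DERIV_pos_inc_right[OF assms(1)] by auto
  then have "f x < f (x + d / 2)" by simp
  then show False using assms(2)[of "d / 2"] \<open>d > 0\<close> by simp
qed

text \<open>The Schwarz lemma for \<open>z \<mapsto> w (a * z) / w a\<close> covers
  \<open>norm v < 1\<close>; continuity up to the circle of radius \<open>norm a\<close> covers
  \<open>norm v = 1\<close>, the case that motion along this circle requires.\<close>

lemma schwarz_scaled:
  fixes w :: "complex \<Rightarrow> complex"
  assumes "w holomorphic_on \<D>" "a \<in> \<D>" "w 0 = 0"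
    and less: "\<And>z. norm z < norm a \<Longrightarrow> norm (w z) < norm (w a)"
    and "norm v \<le> 1"
  shows "norm (w (a * v)) \<le> norm v * norm (w a)"
proof (cases "norm v < 1 \<and> a \<noteq> 0")
  case True
  define f where "f z = w (a * z) / w a" for z
  have a0: "w a \<noteq> 0" using less[of 0] True by auto
  have small: "norm (a * z) < norm a" if "norm z < 1" for z
    using that True by (simp add: norm_mult)
  have "(w \<circ> (\<lambda>z. a * z)) holomorphic_on \<D>"
    by (rule holomorphic_on_compose_gen[OF _ assms(1)])
       (use less_trans[OF small] assms(2) in \<open>auto intro!: holomorphic_intros simp del: norm_mult\<close>)
  then have "f holomorphic_on \<D>"
    unfolding f_def using a0 by (auto simp: o_def intro!: holomorphic_intros)
  moreover have "f 0 = 0" using assms(3) by (simp add: f_def)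
  moreover have "norm (f z) < 1" if "norm z < 1" for z
    using less[OF small[OF that]] a0 by (simp add: f_def norm_divide)
  ultimately have "norm (f v) \<le> norm v"
    using Schwarz_Lemma(1)[of f v] True by auto
  then show ?thesis using a0 by (simp add: f_def norm_divide field_simps)
next
  case False
  then consider "norm v = 1" | "a = 0" using assms(5) by force
  then show ?thesis
  proof cases
    case 1
    have "a * v \<in> closure (ball 0 (norm a))" if "a \<noteq> 0"
      using that 1 by (simp add: norm_mult)
    moreover have "continuous_on (closure (ball 0 (norm a))) w" if "a \<noteq> 0"
      using that assms(2) by (auto intro!: holomorphic_on_imp_continuous_on
        holomorphic_on_subset[OF assms(1)])
    ultimately show ?thesis
      using continuous_on_closure_norm_le[of "ball 0 (norm a)" w "norm (w a)" "a * v"]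
        less 1 by (cases "a = 0") (auto simp: less_imp_le)
  qed (use assms(3) in simp)
qed

text \<open>The Schwarz bound along the curves \<open>a * exp (t * u)\<close>, \<open>Re u \<le> 0\<close>, is an equality at \<open>t = 0\<close>;
  differentiating there gives \<open>Re (m u) \<le> Re u\<close>, where \<open>m = a w'(a) / w(a)\<close>.
  The directions \<open>u = \<plusminus>\<i>\<close> make \<open>m\<close> real, and \<open>u = -1\<close> gives \<open>m \<ge> 1\<close>.\<close>
lemma jack_lemma:
  fixes w :: "complex \<Rightarrow> complex"
  assumes holw: "w holomorphic_on \<D>" and a: "a \<in> \<D>" "a \<noteq> 0" and w0: "w 0 = 0"
    and less: "\<And>z. norm z < norm a \<Longrightarrow> norm (w z) < norm (w a)"
  obtains m :: real where "m \<ge> 1" "a * deriv w a = of_real m * w a"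
proof -
  have wa: "w a \<noteq> 0" using less[of 0] a by auto
  define m where "m = a * deriv w a / w a"
  have key: "Re (m * u) \<le> Re u" if u: "Re u \<le> 0" for u
  proof -
    define F where "F t = w (a * exp (of_real t * u)) / w a" for t :: real
    \<comment> \<open>\<open>f\<close> vanishes at 0 and is nonpositive for \<open>t > 0\<close>.
      Squaring turns the norm into a polynomial in \<open>Re (F t)\<close> and
      \<open>Im (F t)\<close>, which is easy to differentiate.\<close>
    define f where "f t = (norm (F t))\<^sup>2 - exp (2 * t * Re u)" for t
    have F0: "F 0 = 1" using wa by (simp add: F_def)
    have "(w has_field_derivative deriv w a) (at (a * exp (of_real 0 * u)))"
      using holomorphic_derivI[OF holw _ a(1)] by simp
    moreover have "((\<lambda>t. a * exp (of_real t * u)) has_vector_derivative a * u) (at (0::real))"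
      using exp_scaleR_has_vector_derivative_right[of u 0 UNIV]
      by (auto intro!: has_vector_derivative_mult_right simp: scaleR_conv_of_real)
    ultimately have "((w \<circ> (\<lambda>t::real. a * exp (of_real t * u))) has_vector_derivative
        (a * u) * deriv w a) (at 0)"
      using field_vector_diff_chain_at by blast
    then have "(F has_vector_derivative (a * u) * deriv w a / w a) (at 0)"
      unfolding F_def o_def by (rule has_vector_derivative_divide)
    then have F': "(F has_vector_derivative m * u) (at 0)"
      by (simp add: m_def mult_ac)
    have "((\<lambda>t. (Re (F t))\<^sup>2 + (Im (F t))\<^sup>2 - exp (2 * t * Re u)) has_real_derivative
        2 * Re (m * u) - 2 * Re u) (at 0)"
    proof -
      have "((\<lambda>t. Re (F t)) has_real_derivative Re (m * u)) (at 0)"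
        "((\<lambda>t. Im (F t)) has_real_derivative Im (m * u)) (at 0)"
        using F' unfolding has_vector_derivative_complex_iff by auto
      note [derivative_intros] = this
      show ?thesis by (rule derivative_eq_intros refl)+ (simp add: F0)
    qed
    then have "(f has_real_derivative 2 * Re (m * u) - 2 * Re u) (at 0)"
      by (simp add: f_def [abs_def] cmod_power2)
    moreover have "f (0 + t) \<le> f 0" if "t > 0" for t
    proof -
      have tu: "t * Re u \<le> 0" using that u by (simp add: mult_nonneg_nonpos)
      have "norm (w (a * exp (of_real t * u))) \<le> norm (exp (of_real t * u)) * norm (w a)"
        by (rule schwarz_scaled[OF holw a(1) w0 less]) (use tu in auto)
      then have "norm (F t) \<le> exp (t * Re u)"
        using wa by (simp add: F_def norm_divide field_simps)
      then have "(norm (F t))\<^sup>2 \<le> (exp (t * Re u))\<^sup>2"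
        by (intro power_mono) auto
      also have "\<dots> = exp (2 * t * Re u)"
        by (simp add: power2_eq_square flip: exp_add)
      finally show ?thesis using F0 by (simp add: f_def)
    qed
    ultimately have "2 * Re (m * u) - 2 * Re u \<le> 0"
      by (rule has_real_derivative_nonpos_if_max_right)
    then show ?thesis by simp
  qed
  have "Im m = 0" "Re m \<ge> 1" using key[of \<i>] key[of "-\<i>"] key[of "-1"] by auto
  then have "m = of_real (Re m)" by (simp add: complex_eq_iff)
  then have "a * deriv w a = of_real (Re m) * w a" using wa by (simp add: m_def field_simps)
  then show ?thesis using that \<open>Re m \<ge> 1\<close> by blast
qed

section \<open>Zeros of solutions of a first-order equation\<close>

text \<open>At a zero of order \<open>n\<close>, \<open>p z = (z - a)^n * g z\<close> with
  \<open>g\<close> zero-free. The equation, divided by \<open>(z - a)^(n - 1)\<close> off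
  \<open>a\<close> and continued to \<open>a\<close>, becomes \<open>c a * n * g a = 0\<close>,
  which is impossible. It is assumed only where \<open>p\<close> is nonzero, so no value of a
  division by zero enters.\<close>

lemma first_order_ode_nonzero:
  fixes p :: "complex \<Rightarrow> complex"
  assumes "p holomorphic_on S" "open S" "connected S" "\<not> p constant_on S"
    and cont: "continuous_on S c" "continuous_on S k"
    and ode: "\<And>z. z \<in> S \<Longrightarrow> p z \<noteq> 0 \<Longrightarrow> c z * deriv p z = k z * p z"
    and a: "a \<in> S" "c a \<noteq> 0"
  shows "p a \<noteq> 0"
proof
  assume "p a = 0"
  then obtain g r n where n: "0 < n" and r: "0 < r" "ball a r \<subseteq> S"
    and holg: "g holomorphic_on ball a r"
    and pg: "\<And>z. z \<in> ball a r \<Longrightarrow> p z = (z - a)^n * g z"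
    and g0: "\<And>z. z \<in> ball a r \<Longrightarrow> g z \<noteq> 0"
    using holomorphic_factor_zero_nonconstant[OF assms(1-3) a(1) _ assms(4)] by metis
  define L where "L z = c z * (of_nat n * g z + (z - a) * deriv g z)" for z
  define R where "R z = k z * (z - a) * g z" for z
  have ab: "a \<in> ball a r" using r by simp
  have eq: "L z = R z" if z: "z \<in> ball a r" "z \<noteq> a" for z
  proof -
    have "((\<lambda>z. (z - a)^n * g z) has_field_derivative
        (of_nat n * (z - a)^(n - 1) * g z + deriv g z * (z - a)^n)) (at z)"
      using holomorphic_derivI[OF holg _ z(1)] by (auto intro!: derivative_eq_intros)
    then have "(p has_field_derivative
        (of_nat n * (z - a)^(n - 1) * g z + deriv g z * (z - a)^n)) (at z)"
      by (rule has_field_derivative_transform_within_open[of _ _ _ "ball a r"])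
         (use z pg in auto)
    then have "deriv p z = of_nat n * (z - a)^(n - 1) * g z + deriv g z * (z - a)^n"
      by (rule DERIV_imp_deriv)
    moreover have "p z \<noteq> 0" using pg g0 z by auto
    moreover have "z \<in> S" using z r by auto
    ultimately have "c z * (of_nat n * (z - a)^(n - 1) * g z + deriv g z * (z - a)^n)
        = k z * ((z - a)^n * g z)"
      using ode[of z] pg[OF z(1)] by simp
    moreover have "(z - a)^n = (z - a)^(n - 1) * (z - a)"
      using n by (simp flip: power_Suc2)
    ultimately have "(z - a)^(n - 1) * L z = (z - a)^(n - 1) * R z"
      by (simp add: L_def R_def algebra_simps)
    then show ?thesis using z by simp
  qed
  have "continuous_on (ball a r) (\<lambda>z. L z - R z)"
    unfolding L_def R_def using r holg
    by (intro continuous_intros continuous_on_subset[OF cont(1)] continuous_on_subset[OF cont(2)]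
        holomorphic_on_imp_continuous_on[OF holg]
        holomorphic_on_imp_continuous_on[OF holomorphic_deriv[OF holg]]) auto
  then have "isCont (\<lambda>z. L z - R z) a"
    using r by (simp add: continuous_on_eq_continuous_at)
  then have "(\<lambda>z. L z - R z) \<midarrow>a\<rightarrow> L a - R a" by (simp add: isCont_def)
  moreover have "(\<lambda>z. L z - R z) \<midarrow>a\<rightarrow> 0"
  proof (rule tendsto_eventually)
    show "\<forall>\<^sub>F z in at a. L z - R z = 0"
      using eventually_at_in_open[of "ball a r" a] r eq
      by (auto elim!: eventually_mono)
  qed
  ultimately have "L a - R a = 0" using LIM_unique by blast
  then show False using n a(2) g0[OF ab] by (simp add: L_def R_def)
qed

section \<open>Geometry of the lemniscate |s^2 - 1| = 1\<close>

text \<open>A nonzero imaginary value of \<open>p\<close> would give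
  \<open>norm ((p z)\<^sup>2 - 1) = 1 + (Im (p z))\<^sup>2 > 1\<close>. So \<open>Re (p z)\<close>
  never vanishes and keeps its sign on a connected set. The non-strict bound admits closed discs on
  which the lemniscate is reached.\<close>

lemma Re_pos_of_square_near_1:
  fixes p :: "complex \<Rightarrow> complex"
  assumes "connected S" "continuous_on S p" "a \<in> S" "Re (p a) > 0"
    and nz: "\<And>z. z \<in> S \<Longrightarrow> p z \<noteq> 0"
    and le: "\<And>z. z \<in> S \<Longrightarrow> norm ((p z)\<^sup>2 - 1) \<le> 1"
    and b: "b \<in> S"
  shows "Re (p b) > 0"
proof (rule ccontr)
  assume neg: "\<not> Re (p b) > 0"
  have "connected ((\<lambda>z. Re (p z)) ` S)"
    by (intro connected_continuous_image continuous_intros assms)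
  then have "0 \<in> (\<lambda>z. Re (p z)) ` S"
    using connectedD_interval[of _ "Re (p b)" "Re (p a)" 0] neg assms by auto
  then obtain z where z: "z \<in> S" "Re (p z) = 0" by auto
  then have "(p z)\<^sup>2 - 1 = of_real (- (Im (p z))\<^sup>2 - 1)"
    by (simp add: complex_eq_iff power2_eq_square)
  then have "norm ((p z)\<^sup>2 - 1) = (Im (p z))\<^sup>2 + 1"
    by (simp only: norm_of_real) (use zero_le_power2[of "Im (p z)"] in linarith)
  then show False using le[OF z(1)] nz[OF z(1)] z(2) by (simp add: complex_eq_iff)
qed

text \<open>With \<open>r = |s|\<^sup>2\<close>, the equation of the lemniscate becomes \<open>Re (s\<^sup>2) = r\<^sup>2 / 2\<close>,
  whence \<open>Re (s\<^sup>3) = Re s * r * (r - 1)\<close>.\<close>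
lemma lemniscate_Re_cube:
  assumes "norm (s\<^sup>2 - 1) = 1" "Re s > 0"
  shows "Re (s ^ 3) \<ge> - 1 / 4"
proof -
  define x y r where "x = Re s" and "y = Im s" and "r = x\<^sup>2 + y\<^sup>2"
  have "(norm (s\<^sup>2 - 1))\<^sup>2 = 1" using assms by simp
  then have "(x\<^sup>2 - y\<^sup>2 - 1)\<^sup>2 + (2 * x * y)\<^sup>2 = 1"
    unfolding cmod_power2 by (simp add: x_def y_def power2_eq_square mult_ac)
  then have d: "2 * (x\<^sup>2 - y\<^sup>2) = r\<^sup>2" unfolding r_def by algebra
  have "Re (s ^ 3) = x * (x\<^sup>2 - 3 * y\<^sup>2)"
    by (simp add: power3_eq_cube x_def y_def power2_eq_square algebra_simps)
  \<comment> \<open>The left side is \<open>2 * (x\<^sup>2 - y\<^sup>2) - r\<close>.\<close>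
  also have "x\<^sup>2 - 3 * y\<^sup>2 = r * (r - 1)" using d by (simp add: r_def) algebra
  finally have eq: "Re (s ^ 3) = x * (r * (r - 1))" .
  have x: "x > 0" and r: "r \<ge> 0" using assms by (auto simp: x_def r_def)
  show ?thesis
  \<comment> \<open>The value can be negative only for \<open>r < 1\<close>; there
    \<open>x \<le> 1\<close>, and \<open>r * (1 - r)\<close> is at most 1/4.\<close>
  proof (cases "r \<ge> 1")
    case True
    then have "x * (r * (r - 1)) \<ge> 0" using x by simp
    then show ?thesis unfolding eq by linarith
  next
    case False
    then have "x\<^sup>2 \<le> 1\<^sup>2" by (simp add: r_def) (smt (verit) zero_le_power2)
    then have "x \<le> 1" by (rule power2_le_imp_le) simp
    moreover have "r * (1 - r) \<le> 1 / 4"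
      using zero_le_power2[of "r - 1/2"] by (simp add: power2_eq_square algebra_simps)
    ultimately have "x * (r * (1 - r)) \<le> 1 * (1 / 4)"
      using x r False by (intro mult_mono) auto
    then show ?thesis unfolding eq by (simp add: algebra_simps)
  qed
qed

text \<open>After multiplication by \<open>norm (s ^ 3)\<close> and squaring, the claim is
  \<open>c * (2 * Re (s ^ 3) + c) \<ge> 0\<close>, which follows from
  \<open>Re (s ^ 3) \<ge> - 1 / 4\<close>.\<close>

lemma lemniscate_norm_ge_1:
  assumes s: "norm (s\<^sup>2 - 1) = 1" "Re s > 0" and "c \<ge> 1 / 2"
  shows "norm (1 + of_real c / s ^ 3) \<ge> 1"
proof -
  have s0: "s \<noteq> 0" using s by auto
  have "(norm (s ^ 3 + of_real c))\<^sup>2 = (norm (s ^ 3))\<^sup>2 + c * (2 * Re (s ^ 3) + c)"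
    unfolding cmod_power2 by (simp add: power2_eq_square algebra_simps)
  moreover have "c * (2 * Re (s ^ 3) + c) \<ge> 0"
    using lemniscate_Re_cube[OF s] assms(3) by (intro mult_nonneg_nonneg) auto
  ultimately have "(norm (s ^ 3))\<^sup>2 \<le> (norm (s ^ 3 + of_real c))\<^sup>2" by linarith
  then have "norm (s ^ 3) \<le> norm (s ^ 3 + of_real c)" by (rule power2_le_imp_le) simp
  also have "s ^ 3 + of_real c = s ^ 3 * (1 + of_real c / s ^ 3)"
    using s0 by (simp add: field_simps)
  finally show ?thesis using s0 by (simp add: norm_mult)
qed

section \<open>The first point where |w| reaches 1, and the subordination\<close>

text \<open>\<open>a\<close> has least modulus in the compact set of points of
  \<open>cball 0 (norm b)\<close> with \<open>norm (w z) \<ge> 1\<close>. Continuity carries the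
  bound 1 from the open disc to its boundary, which forces \<open>norm (w a) = 1\<close>.\<close>

lemma first_point_norm_eq_1:
  fixes w :: "complex \<Rightarrow> complex"
  assumes cont: "continuous_on \<D> w" and "w 0 = 0" and b: "b \<in> \<D>" "norm (w b) \<ge> 1"
  obtains a where "a \<in> \<D>" "a \<noteq> 0" "norm (w a) = 1"
    "\<And>z. norm z < norm a \<Longrightarrow> norm (w z) < 1" "\<And>z. norm z \<le> norm a \<Longrightarrow> norm (w z) \<le> 1"
proof -
  define K where "K = {z \<in> cball 0 (norm b). norm (w z) \<in> {1..}}"
  have sub: "cball 0 (norm b) \<subseteq> \<D>" using b by auto
  have "closed K" unfolding K_def
    using continuous_closed_preimage[of "cball 0 (norm b)" "\<lambda>z. norm (w z)" "{1..}"]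
    by (auto simp: vimage_def Int_def intro!: continuous_intros continuous_on_subset[OF cont sub])
  moreover have "bounded K" unfolding K_def by (rule bounded_subset[OF bounded_cball[of 0 "norm b"]]) auto
  ultimately have "compact K" by (simp add: compact_eq_bounded_closed)
  moreover have "b \<in> K" using b by (simp add: K_def)
  ultimately obtain a where aK: "a \<in> K" and min: "\<And>z. z \<in> K \<Longrightarrow> norm a \<le> norm z"
    using continuous_attains_inf[of K norm] by (auto intro: continuous_intros)
  have aD: "a \<in> \<D>" and ge: "norm (w a) \<ge> 1" using aK sub by (auto simp: K_def)
  have a0: "a \<noteq> 0" using ge assms(2) by auto
  have less: "norm (w z) < 1" if "norm z < norm a" for z
    using min[of z] that aK by (force simp: K_def)
  have le: "norm (w z) \<le> 1" if "norm z \<le> norm a" for z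
  proof -
    have "continuous_on (closure (ball 0 (norm a))) w"
      using a0 aD by (intro continuous_on_subset[OF cont]) auto
    then show ?thesis
      using continuous_on_closure_norm_le[of "ball 0 (norm a)" w 1 z] less that a0
      by (auto simp: less_imp_le)
  qed
  show ?thesis using that[OF aD a0 _ less le] ge le[of a] by auto
qed

theorem lemma3p8:
  fixes \<beta> :: real and p :: "complex \<Rightarrow> complex"
  assumes "\<beta> > 2 * sqrt 2"
    and "p holomorphic_on \<D>"
    and "p 0 = 1"
    and "(\<lambda>z. (p z)\<^sup>2 + complex_of_real \<beta> * z * deriv p z / (p z)\<^sup>2) \<prec> (\<lambda>z. 1 + z)"
  shows "p \<prec> (\<lambda>z. csqrt (1 + z))"
proof -
  note holp = assms(2)
  have "sqrt 2 \<ge> 1" by simp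
  then have \<beta>: "\<beta> \<ge> 2" using assms(1) by linarith
  have contp: "continuous_on \<D> p" using holp by (rule holomorphic_on_imp_continuous_on)
  obtain v where holv: "v holomorphic_on \<D>" and v: "v ` \<D> \<subseteq> \<D>"
    and pv: "\<And>z. z \<in> \<D> \<Longrightarrow> (p z)\<^sup>2 + of_real \<beta> * z * deriv p z / (p z)\<^sup>2 = 1 + v z"
    using assms(4) unfolding subordinate_def by blast
  have contv: "continuous_on \<D> v" using holv by (rule holomorphic_on_imp_continuous_on)
  have nz: "p a \<noteq> 0" if a: "a \<in> \<D>" for a
  proof
    assume pa: "p a = 0"
    have nc: "\<not> p constant_on \<D>"
      using pa a assms(3) unfolding constant_on_def by (metis centre_in_ball zero_less_one zero_neq_one)
    \<comment> \<open>Clearing the denominator leaves \<open>(p z)\<^sup>2\<close> on the right; one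
      factor is absorbed into a continuous coefficient. The coefficient of \<open>deriv p z\<close>
      vanishes only at 0, where \<open>p\<close> is 1.\<close>
    have ode: "of_real \<beta> * z * deriv p z = ((1 + v z - (p z)\<^sup>2) * p z) * p z"
      if "z \<in> \<D>" "p z \<noteq> 0" for z
      proof -
      have "of_real \<beta> * z * deriv p z / (p z)\<^sup>2 = 1 + v z - (p z)\<^sup>2"
        using pv[OF that(1)] by (simp add: algebra_simps)
      then have "of_real \<beta> * z * deriv p z = (1 + v z - (p z)\<^sup>2) * (p z)\<^sup>2"
        using that(2) by (simp only: divide_eq_eq power_eq_0_iff) simp
      then show ?thesis by (simp only: power2_eq_square mult.assoc)
    qed
    have "continuous_on \<D> (\<lambda>z. (1 + v z - (p z)\<^sup>2) * p z)"
      by (intro continuous_intros contp contv)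
    moreover have "continuous_on \<D> (\<lambda>z. of_real \<beta> * z)"
      by (intro continuous_intros)
    moreover have "of_real \<beta> * a \<noteq> 0" using pa assms(3) \<beta> by auto
    ultimately have "p a \<noteq> 0"
      using first_order_ode_nonzero[OF holp open_ball connected_ball nc _ _ ode a] by blast
    then show False using pa by simp
  qed
  define w where "w z = (p z)\<^sup>2 - 1" for z
  have holw: "w holomorphic_on \<D>" unfolding w_def by (intro holomorphic_intros holp)
  have w0: "w 0 = 0" by (simp add: w_def assms(3))
  have wlt: "norm (w z) < 1" if z: "z \<in> \<D>" for z
  proof (rule ccontr)
    assume "\<not> norm (w z) < 1"
    then have "norm (w z) \<ge> 1" by simp
    then obtain a where a: "a \<in> \<D>" "a \<noteq> 0" "norm (w a) = 1"
      and less: "\<And>z. norm z < norm a \<Longrightarrow> norm (w z) < 1"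
      and le: "\<And>z. norm z \<le> norm a \<Longrightarrow> norm (w z) \<le> 1"
      using first_point_norm_eq_1[OF holomorphic_on_imp_continuous_on[OF holw] w0 z] by metis
    obtain m where m: "m \<ge> 1" "a * deriv w a = of_real m * w a"
      using jack_lemma[OF holw a(1,2) w0] less a(3) by metis
    have "(w has_field_derivative 2 * p a * deriv p a) (at a)"
      unfolding w_def using holomorphic_derivI[OF holp _ a(1)]
      by (auto intro!: derivative_eq_intros)
    then have "deriv w a = 2 * p a * deriv p a" by (rule DERIV_imp_deriv)
    then have eq: "2 * p a * (a * deriv p a) = of_real m * w a" using m(2) by (simp add: mult_ac)
    have cb: "cball 0 (norm a) \<subseteq> \<D>" using a by auto
    \<comment> \<open>The closed disc joins 0, where \<open>p\<close> is 1, to \<open>a\<close>;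
      this places \<open>p a\<close> on the right-hand loop of the lemniscate.\<close>
    have Re: "Re (p a) > 0"
      by (rule Re_pos_of_square_near_1[where S = "cball 0 (norm a)" and a = 0])
         (use nz le cb assms(3) in \<open>auto simp: w_def intro: continuous_on_subset[OF contp]\<close>)
    have "v a = w a + of_real \<beta> * (a * deriv p a) / (p a)\<^sup>2"
      using pv[OF a(1)] by (simp add: w_def algebra_simps)
    \<comment> \<open>Jack's relation with w' = 2 p p' eliminates the derivative; the 2 here
      produces \<open>\<beta> * m / 2\<close>.\<close>
    also have "a * deriv p a = of_real m * w a / (2 * p a)"
      using eq nz[OF a(1)] by (simp add: field_simps)
    also have "w a + of_real \<beta> * (of_real m * w a / (2 * p a)) / (p a)\<^sup>2
        = w a * (1 + of_real (\<beta> * m / 2) / (p a) ^ 3)"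
      using nz[OF a(1)] by (simp add: field_simps power2_eq_square power3_eq_cube)
    finally have "norm (v a) = norm (1 + of_real (\<beta> * m / 2) / (p a) ^ 3)"
      using a(3) by (simp add: norm_mult)
    moreover have "\<beta> * m / 2 \<ge> 1 / 2"
      using mult_mono[of 2 \<beta> 1 m] \<beta> m(1) by simp
    ultimately have "norm (v a) \<ge> 1"
      using lemniscate_norm_ge_1[OF _ Re, of "\<beta> * m / 2"] a(3) by (simp add: w_def)
    then show False using v a(1) by force
  qed
  have Re: "Re (p z) > 0" if "z \<in> \<D>" for z
    by (rule Re_pos_of_square_near_1[where S = \<D> and a = 0])
       (use nz wlt contp assms(3) that in \<open>auto simp: w_def less_imp_le\<close>)
  have pos: "1 + z \<notin> \<real>\<^sub>\<le>\<^sub>0" if "z \<in> \<D>" for z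
    using that abs_Re_le_cmod[of z] by (auto simp: complex_nonpos_Reals_iff)
  have "(\<lambda>z. csqrt (1 + z)) holomorphic_on \<D>"
    using pos by (auto intro!: holomorphic_intros)
  \<comment> \<open>As \<open>Re (p z) > 0\<close>, \<open>p z\<close> is the principal root of its
    square, so \<open>w\<close> itself witnesses the subordination.\<close>
  moreover have "p z = csqrt (1 + w z)" if "z \<in> \<D>" for z
    using csqrt_square[of "p z"] Re[OF that] by (simp add: w_def)
  ultimately show ?thesis
    unfolding subordinate_def using holp holw w0 wlt by (auto intro!: exI[of _ w])
qed

end
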